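(* Let $x,y:I\subset\mathbb{R}_*\to\mathbb{E}_*^3$ be a pair of multiplicative Bertrand partner curves, with $y(s)=x(s)+_*\lambda\cdot_*n(s)$, where $n$ is the multiplicative principal normal of $x$, and let $\kappa,\tau$ be the multiplicative curvature and torsion of $x$. Then there is a constant $\mu\in\mathbb{R}_*$ such that, on $I$, $$\kappa^{\log\lambda}+_*\tau^{\log\mu}=e .$$
   Context: Multiplicative numbers: $\mathbb{R}_*=(0,\infty)$ with $a+_*b=ab$, $a-_*b=a/b$, $a\cdot_*b=e^{\log a\log b}=a^{\log b}$, $a/_*b=e^{\log a/\log b}$ ($b\ne1$), $-_*a=1/a$, $0_*=1$, $1_*=e$. Vectors: $\mathbb{R}_*^3=(0,\infty)^3$ with componentwise $+_*$ and scalar multiplication $a\cdot_*u=(a\cdot_*u_1,a\cdot_*u_2,a\cdot_*u_3)$; $\log u=(\log u_1,\log u_2,\log u_3)$; inner product $\langle u,v\rangle_*=e^{\langle\log u,\log v\rangle}$; norm $\|u\|_*=e^{\langle\log u,\log u\rangle^{1/2}}$; cross product $u\times_*v$ defined by $\log(u\times_*v)=\log u\times\log v$. $\mathbb{E}_*^3$ is $\mathbb{R}_*^3$ with this structure. The multiplicative derivative of $f:I\subset\mathbb{R}_*\to\mathbb{R}_*$ is $f^*(s)=e^{sf'(s)/f(s)}$; vector functions are differentiated componentwise. Curves: $I\subset\mathbb{R}_*$ is an open interval; a curve is a map $I\to\mathbb{E}_*^3$ that is sufficiently often continuously multiplicative differentiable. It is regular if $\|x^*\|_*\ne0_*$ everywhere,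 and naturally parametrized if $\|x^*\|_*=1_*=e$ everywhere. For a naturally parametrized curve with $\|x^{**}\|_*\neq 0_*$, the multiplicative Frenet frame is $t=x^*$, $n=x^{**}/_*\|x^{**}\|_*$ (multiplicative division by a scalar, componentwise), $b=t\times_*n$, and its curvature and torsion are $\kappa=\|x^{**}\|_*$, $\tau=\langle n^*,b\rangle_*$. The Frenet apparatus of a regular curve at a parameter value is that of its natural reparametrization at the corresponding point. Curves considered are assumed to possess a Frenet frame. Bertrand partner: for curves $x,y:I\to\mathbb{E}_*^3$ with Frenet frames $\{t,n,b\}$ and $\{\bar t,\bar n,\bar b\}$, $y$ is a multiplicative Bertrand partner curve of $x$ if $n(s)=\bar n(s)$ for all $s\in I$ and $y(s)=x(s)+_*\lambda\cdot_*n(s)$ for $\lambda$ with values in $\mathbb{R}_*$.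
   Formalization: The formal theorem adds that λ is not identically 0_* and τ is not identically 0_* on I; otherwise the claim fails (y = x with nonconstant torsion; concentric multiplicative circles with log κ = 1, log λ = 1/2). *)

theory Defs
  imports "HOL-Analysis.Analysis"
begin

text \<open>
  Multiplicative numbers are represented by positive reals and vectors of multiplicative
  3-space by elements of \<^typ>\<open>real^3\<close> with positive components; positivity is required
  explicitly of curves and of scalars (\<open>mult_curve\<close>, \<open>bertrand_partner\<close>). On other
  arguments the operations below have no meaning.
\<close>

abbreviation mult_zero :: real where "mult_zero \<equiv> 1"
abbreviation mult_one :: real where "mult_one \<equiv> exp 1"

definition mult_add :: "real \<Rightarrow> real \<Rightarrow> real" (infixl "+\<^sub>*" 65)
  where "a +\<^sub>* b = a * b"

definition mult_times :: "real \<Rightarrow> real \<Rightarrow> real" (infixl "\<cdot>\<^sub>*" 70)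
  where "a \<cdot>\<^sub>* b = exp (ln a * ln b)"

definition mult_divide :: "real \<Rightarrow> real \<Rightarrow> real" (infixl "'/\<^sub>*" 70)
  where "a /\<^sub>* b = exp (ln a / ln b)"

definition vec_ln :: "real^3 \<Rightarrow> real^3"
  where "vec_ln u = (\<chi> i. ln (u $ i))"

definition vec_exp :: "real^3 \<Rightarrow> real^3"
  where "vec_exp u = (\<chi> i. exp (u $ i))"

definition mult_vadd :: "real^3 \<Rightarrow> real^3 \<Rightarrow> real^3" (infixl "+\<^sub>v" 65)
  where "u +\<^sub>v v = (\<chi> i. u $ i +\<^sub>* v $ i)"

definition mult_vscale :: "real \<Rightarrow> real^3 \<Rightarrow> real^3" (infixr "\<cdot>\<^sub>v" 75)
  where "a \<cdot>\<^sub>v u = (\<chi> i. a \<cdot>\<^sub>* u $ i)"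

definition mult_vdivide :: "real^3 \<Rightarrow> real \<Rightarrow> real^3" (infixl "'/\<^sub>v" 70)
  where "u /\<^sub>v a = (\<chi> i. u $ i /\<^sub>* a)"

definition mult_inner :: "real^3 \<Rightarrow> real^3 \<Rightarrow> real"
  where "mult_inner u v = exp (vec_ln u \<bullet> vec_ln v)"

definition mult_norm :: "real^3 \<Rightarrow> real"
  where "mult_norm u = exp (sqrt (vec_ln u \<bullet> vec_ln u))"

definition mult_cross :: "real^3 \<Rightarrow> real^3 \<Rightarrow> real^3"
  where "mult_cross u v = vec_exp (cross3 (vec_ln u) (vec_ln v))"

definition mult_deriv :: "(real \<Rightarrow> real) \<Rightarrow> real \<Rightarrow> real"
  where "mult_deriv f s = exp (s * deriv f s / f s)"

definition mult_vderiv :: "(real \<Rightarrow> real^3) \<Rightarrow> real \<Rightarrow> real^3"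
  where "mult_vderiv x s = (\<chi> i. mult_deriv (\<lambda>r. x r $ i) s)"

text \<open>
  For positive functions on a subset of the positive reals, multiplicative differentiability is
  the same as differentiability.
\<close>

definition mult_Ck_on :: "nat \<Rightarrow> real set \<Rightarrow> (real \<Rightarrow> real) \<Rightarrow> bool"
  where "mult_Ck_on k I f \<longleftrightarrow>
    (\<forall>s\<in>I. 0 < f s) \<and>
    (\<forall>j<k. \<forall>s\<in>I. ((mult_deriv ^^ j) f) differentiable (at s)) \<and>
    (\<forall>j\<le>k. continuous_on I ((mult_deriv ^^ j) f))"

definition mult_open_interval :: "real set \<Rightarrow> bool"
  where "mult_open_interval I \<longleftrightarrow> I \<noteq> {} \<and> open I \<and> is_interval I \<and> I \<subseteq> {0<..}"

text \<open>Order three is the least for which torsion, involving \<open>x\<^sup>*\<^sup>*\<^sup>*\<close>, makes sense.\<close>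

definition mult_curve :: "real set \<Rightarrow> (real \<Rightarrow> real^3) \<Rightarrow> bool"
  where "mult_curve I x \<longleftrightarrow> mult_open_interval I \<and> (\<forall>i. mult_Ck_on 3 I (\<lambda>s. x s $ i))"

definition mult_regular :: "real set \<Rightarrow> (real \<Rightarrow> real^3) \<Rightarrow> bool"
  where "mult_regular I x \<longleftrightarrow>
    mult_curve I x \<and> (\<forall>s\<in>I. mult_norm (mult_vderiv x s) \<noteq> mult_zero)"

definition naturally_parametrized :: "real set \<Rightarrow> (real \<Rightarrow> real^3) \<Rightarrow> bool"
  where "naturally_parametrized I x \<longleftrightarrow>
    mult_curve I x \<and> (\<forall>s\<in>I. mult_norm (mult_vderiv x s) = mult_one)"

text \<open>Frenet apparatus of a naturally parametrized curve.\<close>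

definition nat_curvature :: "(real \<Rightarrow> real^3) \<Rightarrow> real \<Rightarrow> real"
  where "nat_curvature x s = mult_norm (mult_vderiv (mult_vderiv x) s)"

definition nat_tangent :: "(real \<Rightarrow> real^3) \<Rightarrow> real \<Rightarrow> real^3"
  where "nat_tangent x s = mult_vderiv x s"

definition nat_normal :: "(real \<Rightarrow> real^3) \<Rightarrow> real \<Rightarrow> real^3"
  where "nat_normal x s =
    mult_vderiv (mult_vderiv x) s /\<^sub>v mult_norm (mult_vderiv (mult_vderiv x) s)"

definition nat_binormal :: "(real \<Rightarrow> real^3) \<Rightarrow> real \<Rightarrow> real^3"
  where "nat_binormal x s = mult_cross (nat_tangent x s) (nat_normal x s)"

definition nat_torsion :: "(real \<Rightarrow> real^3) \<Rightarrow> real \<Rightarrow> real"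
  where "nat_torsion x s = mult_inner (mult_vderiv (nat_normal x) s) (nat_binormal x s)"

text \<open>
  \<open>z\<close> on \<open>J\<close> is a natural reparametrization of \<open>x\<close> on \<open>I\<close>, where \<open>\<phi> : I \<rightarrow> J\<close> maps the given
  parameter to the corresponding natural one. The condition \<open>\<phi>\<^sup>* > 0\<^sub>*\<close> says that
  the change of parameter is regular and preserves the orientation.
\<close>

definition natural_reparametrization ::
    "real set \<Rightarrow> (real \<Rightarrow> real^3) \<Rightarrow> real set \<Rightarrow> (real \<Rightarrow> real) \<Rightarrow> (real \<Rightarrow> real^3) \<Rightarrow> bool"
  where "natural_reparametrization I x J \<phi> z \<longleftrightarrow>
    naturally_parametrized J z \<and>
    mult_Ck_on 3 I \<phi> \<and> bij_betw \<phi> I J \<and> (\<forall>s\<in>I. mult_deriv \<phi> s > mult_zero) \<and>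
    (\<forall>s\<in>I. x s = z (\<phi> s))"

text \<open>
  The regular curve \<open>x\<close> possesses a Frenet frame, and \<open>t, n, b, \<kappa>, \<tau>\<close> are its Frenet apparatus.
  Natural reparametrizations are unique up to a translation of the natural parameter, so the
  values on \<open>I\<close> do not depend on the one chosen.
\<close>

definition frenet_apparatus ::
    "real set \<Rightarrow> (real \<Rightarrow> real^3) \<Rightarrow> (real \<Rightarrow> real^3) \<Rightarrow> (real \<Rightarrow> real^3) \<Rightarrow> (real \<Rightarrow> real^3) \<Rightarrow>
     (real \<Rightarrow> real) \<Rightarrow> (real \<Rightarrow> real) \<Rightarrow> bool"
  where "frenet_apparatus I x t n b \<kappa> \<tau> \<longleftrightarrow>
    mult_regular I x \<and>
    (\<exists>J \<phi> z. natural_reparametrization I x J \<phi> z \<and>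
      (\<forall>s\<in>I. mult_norm (mult_vderiv (mult_vderiv z) (\<phi> s)) \<noteq> mult_zero \<and>
        t s = nat_tangent z (\<phi> s) \<and> n s = nat_normal z (\<phi> s) \<and> b s = nat_binormal z (\<phi> s) \<and>
        \<kappa> s = nat_curvature z (\<phi> s) \<and> \<tau> s = nat_torsion z (\<phi> s)))"

text \<open>
  Here \<open>n\<close> and \<open>n'\<close> are the principal normals of \<open>x\<close> and \<open>y\<close>. The scalar \<open>\<lambda>\<close> is a function of
  the parameter; its constancy is a consequence, not part of the definition.
\<close>

definition bertrand_partner ::
    "real set \<Rightarrow> (real \<Rightarrow> real^3) \<Rightarrow> (real \<Rightarrow> real^3) \<Rightarrow> (real \<Rightarrow> real^3) \<Rightarrow> (real \<Rightarrow> real^3) \<Rightarrow>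
     (real \<Rightarrow> real) \<Rightarrow> bool"
  where "bertrand_partner I x n y n' lam \<longleftrightarrow>
    (\<forall>s\<in>I. n s = n' s) \<and>
    (\<forall>s\<in>I. 0 < lam s \<and> y s = x s +\<^sub>v lam s \<cdot>\<^sub>v n s)"

end

theory Submission
  imports Defs
begin

text \<open>
  Under the coordinatewise logarithm the multiplicative derivative at \<open>s\<close> becomes \<open>s d/ds\<close>, so
  the multiplicative Frenet apparatus turns into the Euclidean one, with an additional speed factor
  \<open>w\<close>. For Bertrand partners \<open>Y = X + \<Lambda> N\<close> with a common normal \<open>N\<close>, differentiating and
  pairing with \<open>N\<close> shows that \<open>\<Lambda>\<close> is constant. The derivatives of \<open>T\<close>, \<open>T'\<close> and \<open>B\<close> are
  multiples of \<open>N\<close>, so \<open>c = T' \<bullet> T\<close> and \<open>d = T' \<bullet> B\<close> are constant. Comparing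
  \<open>Y\<^sup>\<bullet> = w' T'\<close> with \<open>Y\<^sup>\<bullet> = w ((1 - \<Lambda> K) T + \<Lambda> \<tau> B)\<close> gives
  \<open>d (1 - \<Lambda> K) = c \<Lambda> \<tau>\<close>, and \<open>d \<noteq> 0\<close> because \<open>\<Lambda> \<tau>\<close> does not vanish identically.
\<close>

section \<open>Bertrand curves in Euclidean space\<close>

text \<open>The speed \<open>w\<close> is left arbitrary because two sources contribute to it: the
  factor 1/p hidden in the multiplicative derivative, and the derivative of a change of parameter.
  An equation for the derivative of \<open>B\<close> is not listed, since it follows from those for
  \<open>T\<close> and \<open>N\<close>.\<close>

definition frenet_system ::
    "real set \<Rightarrow> (real \<Rightarrow> real) \<Rightarrow> (real \<Rightarrow> real^3) \<Rightarrow> (real \<Rightarrow> real^3) \<Rightarrow> (real \<Rightarrow> real^3) \<Rightarrow>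
     (real \<Rightarrow> real^3) \<Rightarrow> (real \<Rightarrow> real) \<Rightarrow> (real \<Rightarrow> real) \<Rightarrow> bool"
  where "frenet_system I w X T N B K \<tau> \<longleftrightarrow> (\<forall>s\<in>I.
    0 < w s \<and> T s \<bullet> T s = 1 \<and> N s \<bullet> N s = 1 \<and> T s \<bullet> N s = 0 \<and> B s = cross3 (T s) (N s) \<and>
    (X has_vector_derivative w s *\<^sub>R T s) (at s) \<and>
    (T has_vector_derivative (w s * K s) *\<^sub>R N s) (at s) \<and>
    (N has_vector_derivative w s *\<^sub>R (\<tau> s *\<^sub>R B s - K s *\<^sub>R T s)) (at s))"

lemma cross3_frame:
  fixes T N :: "real^3"
  assumes "T \<bullet> T = 1" "N \<bullet> N = 1" "T \<bullet> N = 0" "B = cross3 T N"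
  shows "B \<bullet> B = 1" "B \<bullet> T = 0" "B \<bullet> N = 0" "cross3 T B = - N"
    and "v = (v \<bullet> T) *\<^sub>R T + (v \<bullet> N) *\<^sub>R N + (v \<bullet> B) *\<^sub>R B"
proof -
  show BB: "B \<bullet> B = 1"
    using norm_cross_dot[of T N] assms
    by (simp add: power_mult_distrib power2_norm_eq_inner)
  show BT: "B \<bullet> T = 0" and BN: "B \<bullet> N = 0"
    using assms(4) by (simp_all add: dot_cross_self)
  show "cross3 T B = - N"
    using assms by (simp add: Lagrange)
  show "v = (v \<bullet> T) *\<^sub>R T + (v \<bullet> N) *\<^sub>R N + (v \<bullet> B) *\<^sub>R B"
  proof -
    \<comment> \<open>\<open>u\<close> is orthogonal to \<open>T\<close> and \<open>N\<close>, so
      expanding its product with \<open>cross3 T N\<close> by the triple product formula gives zero.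
      Being also orthogonal to the unit vector \<open>B\<close>, it must vanish.\<close>
    define u where "u = v - ((v \<bullet> T) *\<^sub>R T + (v \<bullet> N) *\<^sub>R N + (v \<bullet> B) *\<^sub>R B)"
    have "N \<bullet> T = 0" "T \<bullet> B = 0" "N \<bullet> B = 0"
      using assms(3) BT BN by (metis inner_commute)+
    then have "u \<bullet> T = 0" "u \<bullet> N = 0" "u \<bullet> B = 0"
      using assms(1-3) BB BT BN
      by (simp_all add: u_def inner_diff_left inner_add_left)
    then have "cross3 u B = 0"
      by (simp add: assms(4) Lagrange)
    then have "u = 0"
      using norm_and_cross_eq_0[of u B] \<open>u \<bullet> B = 0\<close> BB by auto
    then show ?thesis by (simp add: u_def)
  qed
qed

lemma has_vector_derivative_inner:
  fixes f g :: "real \<Rightarrow> 'a::real_inner"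
  assumes "(f has_vector_derivative f') (at s)" "(g has_vector_derivative g') (at s)"
  shows "((\<lambda>r. f r \<bullet> g r) has_real_derivative f s \<bullet> g' + f' \<bullet> g s) (at s)"
  using bounded_bilinear.has_vector_derivative[OF bounded_bilinear_inner assms]
  by (simp add: has_real_derivative_iff_has_vector_derivative)

text \<open>In the product rule for \<open>cross3 T N\<close>, the derivative of \<open>T\<close> is
  parallel to \<open>N\<close> and contributes nothing; in the derivative of \<open>N\<close> only
  the \<open>B\<close> part survives, and \<open>cross3 T B = - N\<close>.\<close>

lemma frenet_system_binormal:
  assumes "frenet_system I w X T N B K \<tau>" "open I" "s \<in> I"
  shows "(B has_vector_derivative - (w s * \<tau> s) *\<^sub>R N s) (at s)"
proof -
  have f: "T s \<bullet> T s = 1" "N s \<bullet> N s = 1" "T s \<bullet> N s = 0" "B s = cross3 (T s) (N s)"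
      "(T has_vector_derivative (w s * K s) *\<^sub>R N s) (at s)"
      "(N has_vector_derivative w s *\<^sub>R (\<tau> s *\<^sub>R B s - K s *\<^sub>R T s)) (at s)"
    using assms unfolding frenet_system_def by blast+
  have "((\<lambda>r. cross3 (T r) (N r)) has_vector_derivative
      cross3 (T s) (w s *\<^sub>R (\<tau> s *\<^sub>R B s - K s *\<^sub>R T s)) + cross3 ((w s * K s) *\<^sub>R N s) (N s)) (at s)"
    using bounded_bilinear.has_vector_derivative[OF _ f(5,6), of cross3]
    by (simp add: bilinear_conv_bounded_bilinear[symmetric] bilinear_cross)
  moreover have "cross3 (T s) (w s *\<^sub>R (\<tau> s *\<^sub>R B s - K s *\<^sub>R T s)) + cross3 ((w s * K s) *\<^sub>R N s) (N s)
      = - (w s * \<tau> s) *\<^sub>R N s"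
    using cross3_frame(4)[OF f(1-4)] by (simp add: cross_mult_left cross_mult_right Cross3.right_diff_distrib)
  ultimately have "((\<lambda>r. cross3 (T r) (N r)) has_vector_derivative - (w s * \<tau> s) *\<^sub>R N s) (at s)"
    by simp
  then show ?thesis
    by (rule has_vector_derivative_transform_within_open[OF _ assms(2,3)])
      (use assms(1) in \<open>simp add: frenet_system_def\<close>)
qed

lemma zero_derivative_imp_constant_on:
  fixes f :: "real \<Rightarrow> real"
  assumes "open I" "connected I" "\<And>s. s \<in> I \<Longrightarrow> (f has_real_derivative 0) (at s)"
  obtains c where "\<And>s. s \<in> I \<Longrightarrow> f s = c"
proof -
  have "f constant_on I"
    by (rule has_field_derivative_0_imp_constant_on)
      (use assms has_field_derivative_at_within in blast)+
  then show ?thesis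
    using that unfolding constant_on_def by blast
qed

theorem euclidean_bertrand:
  fixes X Y T N B T' N' B' :: "real \<Rightarrow> real^3" and K \<tau> K' \<tau>' L w w' :: "real \<Rightarrow> real"
  assumes I: "open I" "connected I"
    and F: "frenet_system I w X T N B K \<tau>"
    and F': "frenet_system I w' Y T' N' B' K' \<tau>'"
    and NN': "\<And>s. s \<in> I \<Longrightarrow> N' s = N s"
    and Y: "\<And>s. s \<in> I \<Longrightarrow> Y s = X s + L s *\<^sub>R N s"
    and L: "\<exists>s\<in>I. L s \<noteq> 0" and \<tau>: "\<exists>s\<in>I. \<tau> s \<noteq> 0"
  obtains m where "\<And>s. s \<in> I \<Longrightarrow> L s * K s + m * \<tau> s = 1"
proof -
  have w: "0 < w s" and TT: "T s \<bullet> T s = 1" and N1: "N s \<bullet> N s = 1" and TN: "T s \<bullet> N s = 0"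
    and B: "B s = cross3 (T s) (N s)"
    and dX: "(X has_vector_derivative w s *\<^sub>R T s) (at s)"
    and dT: "(T has_vector_derivative (w s * K s) *\<^sub>R N s) (at s)"
    and dN: "(N has_vector_derivative w s *\<^sub>R (\<tau> s *\<^sub>R B s - K s *\<^sub>R T s)) (at s)"
    if "s \<in> I" for s
    using F that unfolding frenet_system_def by blast+
  note frame = cross3_frame[OF TT N1 TN B]
  have w': "0 < w' s" and T'N: "T' s \<bullet> N s = 0"
    and dY: "(Y has_vector_derivative w' s *\<^sub>R T' s) (at s)"
    and dT': "(T' has_vector_derivative (w' s * K' s) *\<^sub>R N s) (at s)"
    if "s \<in> I" for s
    using F' NN' that unfolding frenet_system_def by metis+
  \<comment> \<open>On \<open>I\<close>, \<open>L\<close> is the inner product of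
    \<open>Y - X\<close> with \<open>N\<close>. Both terms of its derivative vanish:
    \<open>Y - X\<close> is a multiple of \<open>N\<close>, which is orthogonal to its own
    derivative, and both tangents are orthogonal to \<open>N\<close>.\<close>
  have "(L has_real_derivative 0) (at s)" if s: "s \<in> I" for s
  proof -
    have "((\<lambda>r. (Y r - X r) \<bullet> N r) has_real_derivative
        (Y s - X s) \<bullet> (w s *\<^sub>R (\<tau> s *\<^sub>R B s - K s *\<^sub>R T s)) + (w' s *\<^sub>R T' s - w s *\<^sub>R T s) \<bullet> N s) (at s)"
      by (intro has_vector_derivative_inner has_vector_derivative_diff dX dY dN s)
    moreover have "(Y s - X s) \<bullet> (w s *\<^sub>R (\<tau> s *\<^sub>R B s - K s *\<^sub>R T s)) + (w' s *\<^sub>R T' s - w s *\<^sub>R T s) \<bullet> N s = 0"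
      using Y[OF s] T'N[OF s] TN[OF s] frame(3)[OF s s s s]
      by (simp add: inner_diff_left inner_diff_right inner_commute)
    ultimately have "((\<lambda>r. (Y r - X r) \<bullet> N r) has_real_derivative 0) (at s)"
      by simp
    then show ?thesis
      by (rule has_field_derivative_transform_within_open[OF _ I(1) s]) (simp add: Y N1)
  qed
  then obtain l where l: "\<And>s. s \<in> I \<Longrightarrow> L s = l"
    by (rule zero_derivative_imp_constant_on[OF I]) blast+
  \<comment> \<open>\<open>T'\<close> is the tangent of the partner, not a derivative. It lies in
    the plane of \<open>T\<close> and \<open>B\<close>, so \<open>c\<close> and \<open>d\<close> are
    the cosine and sine of the oriented angle from \<open>T\<close> to \<open>T'\<close>, which is
    thus constant.\<close>
  have "((\<lambda>r. T' r \<bullet> T r) has_real_derivative 0) (at s)" if s: "s \<in> I" for s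
    using has_vector_derivative_inner[OF dT'[OF s] dT[OF s]] T'N[OF s] TN[OF s]
    by (simp add: inner_commute)
  then obtain c where c: "\<And>s. s \<in> I \<Longrightarrow> T' s \<bullet> T s = c"
    by (rule zero_derivative_imp_constant_on[OF I]) blast+
  have "((\<lambda>r. T' r \<bullet> B r) has_real_derivative 0) (at s)" if s: "s \<in> I" for s
    using has_vector_derivative_inner[OF dT'[OF s] frenet_system_binormal[OF F I(1) s]]
      T'N[OF s] frame(3)[OF s s s s]
    by (simp add: inner_commute)
  then obtain d where d: "\<And>s. s \<in> I \<Longrightarrow> T' s \<bullet> B s = d"
    by (rule zero_derivative_imp_constant_on[OF I]) blast+
  \<comment> \<open>These are the \<open>T\<close> and \<open>B\<close> components of the two
    expressions for the derivative of \<open>Y\<close>.\<close>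
  have cmp: "w' s * c = w s * (1 - l * K s)" "w' s * d = w s * (l * \<tau> s)" if s: "s \<in> I" for s
  proof -
    have "((\<lambda>r. X r + l *\<^sub>R N r) has_vector_derivative
        w s *\<^sub>R T s + l *\<^sub>R (w s *\<^sub>R (\<tau> s *\<^sub>R B s - K s *\<^sub>R T s))) (at s)"
      using dX[OF s] dN[OF s] by (auto intro!: derivative_eq_intros)
    then have "(Y has_vector_derivative w s *\<^sub>R T s + l *\<^sub>R (w s *\<^sub>R (\<tau> s *\<^sub>R B s - K s *\<^sub>R T s))) (at s)"
      by (rule has_vector_derivative_transform_within_open[OF _ I(1) s]) (simp add: Y l)
    then have eq: "w' s *\<^sub>R T' s = w s *\<^sub>R T s + l *\<^sub>R (w s *\<^sub>R (\<tau> s *\<^sub>R B s - K s *\<^sub>R T s))"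
      using vector_derivative_unique_at dY[OF s] by blast
    show "w' s * c = w s * (1 - l * K s)"
      using arg_cong[OF eq, of "\<lambda>v. v \<bullet> T s"] c[OF s] TT[OF s] frame(2)[OF s s s s]
      by (simp add: algebra_simps)
    show "w' s * d = w s * (l * \<tau> s)"
      using arg_cong[OF eq, of "\<lambda>v. v \<bullet> B s"] d[OF s] frame(1,2)[OF s s s s]
      by (simp add: inner_commute algebra_simps)
  qed
  obtain s1 where "s1 \<in> I" "\<tau> s1 \<noteq> 0" using \<tau> by blast
  moreover have "l \<noteq> 0" using L l by auto
  ultimately have "d \<noteq> 0" using cmp(2)[of s1] w[of s1] by auto
  \<comment> \<open>Eliminating \<open>w'\<close> from the two identities in \<open>cmp\<close> and
    cancelling \<open>w\<close> gives d (1 - l K) = c l \<tau>. Division by \<open>d\<close>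
    produces the coefficient c l / d of \<tau>.\<close>
  have "L s * K s + (c * l / d) * \<tau> s = 1" if s: "s \<in> I" for s
  proof -
    have "w s * (c * (l * \<tau> s)) = c * (w' s * d)"
      by (simp add: cmp(2)[OF s])
    also have "\<dots> = d * (w' s * c)" by simp
    also have "\<dots> = w s * (d * (1 - l * K s))"
      by (simp add: cmp(1)[OF s])
    finally have "c * (l * \<tau> s) = d * (1 - l * K s)"
      using w[OF s] by simp
    then show ?thesis
      using \<open>d \<noteq> 0\<close> l[OF s] by (simp add: field_simps)
  qed
  then show ?thesis using that by blast
qed

section \<open>Logarithmic coordinates\<close>

lemma vec_ln_vec_exp [simp]: "vec_ln (vec_exp u) = u"
  by (simp add: vec_ln_def vec_exp_def vec_eq_iff)

lemma vec_ln_mult_vdivide [simp]: "vec_ln (u /\<^sub>v a) = (1 / ln a) *\<^sub>R vec_ln u"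
  by (simp add: vec_ln_def mult_vdivide_def mult_divide_def vec_eq_iff)

lemma vec_ln_mult_cross [simp]: "vec_ln (mult_cross u v) = cross3 (vec_ln u) (vec_ln v)"
  by (simp add: mult_cross_def)

lemma vec_ln_mult_translate:
  assumes "\<And>i. 0 < u $ i"
  shows "vec_ln (u +\<^sub>v a \<cdot>\<^sub>v v) = vec_ln u + ln a *\<^sub>R vec_ln v"
  using assms[THEN less_imp_neq]
  by (simp add: vec_ln_def mult_vadd_def mult_vscale_def mult_add_def mult_times_def vec_eq_iff ln_mult)

lemma ln_mult_norm [simp]: "ln (mult_norm u) = norm (vec_ln u)"
  by (simp add: mult_norm_def norm_eq_sqrt_inner)

lemma mult_vderiv_funpow_nth:
  "(mult_vderiv ^^ j) z r $ i = (mult_deriv ^^ j) (\<lambda>q. z q $ i) r"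
  by (induction j arbitrary: r) (simp_all add: mult_vderiv_def)

lemma has_vector_derivative_componentwise_cart:
  fixes f :: "real \<Rightarrow> real^'n"
  assumes "\<And>i. ((\<lambda>r. f r $ i) has_real_derivative f' $ i) (at s)"
  shows "(f has_vector_derivative f') (at s)"
proof -
  have "((\<lambda>r. f r \<bullet> b) has_derivative (\<lambda>h. (h *\<^sub>R f') \<bullet> b)) (at s)" if b: "b \<in> Basis" for b
  proof -
    obtain i where i: "b = axis i 1"
      using b unfolding Basis_vec_def Basis_real_def by blast
    have "((\<lambda>r. f r $ i) has_derivative (\<lambda>h. h * f' $ i)) (at s)"
      using assms[of i]
      by (simp only: has_real_derivative_iff_has_vector_derivative has_vector_derivative_def real_scaleR_def)
    then show ?thesis
      by (simp add: i inner_axis)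
  qed
  then show ?thesis
    unfolding has_vector_derivative_def using has_derivative_componentwise_within[of f] by blast
qed

lemma mult_deriv_funpow_pos:
  assumes "mult_Ck_on k I f" "s \<in> I"
  shows "0 < (mult_deriv ^^ j) f s"
  using assms by (cases j) (auto simp: mult_Ck_on_def mult_deriv_def)

text \<open>For each positive coordinate f, the logarithm of the multiplicative derivative is s f'/f
  = s (ln f)', whence the factor 1/s. The bound on \<open>j\<close> is the order of
  differentiability built into \<open>mult_curve\<close>.\<close>

lemma mult_curve_log_derivative:
  assumes "mult_curve I z" "s \<in> I" "j < 3"
  shows "((\<lambda>r. vec_ln ((mult_vderiv ^^ j) z r)) has_vector_derivative
    (1 / s) *\<^sub>R vec_ln ((mult_vderiv ^^ Suc j) z s)) (at s)"
proof (rule has_vector_derivative_componentwise_cart)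
  fix i
  let ?f = "(mult_deriv ^^ j) (\<lambda>q. z q $ i)"
  have Ck: "mult_Ck_on 3 I (\<lambda>q. z q $ i)" and "0 < s"
    using assms unfolding mult_curve_def mult_open_interval_def by auto
  have pos: "0 < ?f s" by (rule mult_deriv_funpow_pos[OF Ck assms(2)])
  have "(?f has_real_derivative deriv ?f s) (at s)"
    using Ck assms(2,3) unfolding mult_Ck_on_def
    by (meson DERIV_deriv_iff_real_differentiable)
  then have "((\<lambda>r. ln (?f r)) has_real_derivative deriv ?f s / ?f s) (at s)"
    using pos by (auto intro!: derivative_eq_intros)
  moreover have "deriv ?f s / ?f s = (1 / s) * ln ((mult_deriv ^^ Suc j) (\<lambda>q. z q $ i) s)"
    using \<open>0 < s\<close> by (simp add: mult_deriv_def)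
  ultimately show "((\<lambda>r. vec_ln ((mult_vderiv ^^ j) z r) $ i) has_real_derivative
      ((1 / s) *\<^sub>R vec_ln ((mult_vderiv ^^ Suc j) z s)) $ i) (at s)"
    by (simp only: vec_ln_def mult_vderiv_funpow_nth vec_lambda_beta vector_scaleR_component real_scaleR_def)
qed

text \<open>The same relation read backwards, starting from differentiability of the logarithm. It
  serves for \<open>nat_normal\<close>, whose derivative is found in logarithmic coordinates.
  Positivity everywhere lets \<open>w\<close> be recovered as the exponential of its
  logarithm.\<close>

lemma vec_ln_mult_vderiv:
  assumes "((\<lambda>r. vec_ln (w r)) has_vector_derivative D) (at s)" "\<And>r i. 0 < w r $ i"
  shows "vec_ln (mult_vderiv w s) = s *\<^sub>R D"
proof -
  have "ln (mult_deriv (\<lambda>r. w r $ i) s) = s * D $ i" for i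
  proof -
    have "((\<lambda>r. vec_ln (w r) $ i) has_real_derivative D $ i) (at s)"
      using bounded_linear.has_vector_derivative[OF bounded_linear_vec_nth assms(1)]
      by (simp add: has_real_derivative_iff_has_vector_derivative)
    then have "((\<lambda>r. exp (vec_ln (w r) $ i)) has_real_derivative exp (vec_ln (w s) $ i) * D $ i) (at s)"
      by (auto intro!: derivative_eq_intros)
    then have "((\<lambda>r. w r $ i) has_real_derivative w s $ i * D $ i) (at s)"
      using assms(2) by (simp add: vec_ln_def)
    then show ?thesis
      using assms(2)[of s i] by (simp add: mult_deriv_def DERIV_imp_deriv)
  qed
  then show ?thesis by (simp add: vec_ln_def mult_vderiv_def vec_eq_iff)
qed

text \<open>This is the classical derivation of the Frenet equations with d/dp replaced by p d/dp,
  which accounts for the speed 1/p. The equation for \<open>T\<close> holds by the definition of the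
  normal; the one for \<open>N\<close> comes from its components in the frame.\<close>

lemma naturally_parametrized_frenet_system:
  assumes z: "naturally_parametrized J z"
    and nz: "\<And>p. p \<in> J \<Longrightarrow> mult_norm (mult_vderiv (mult_vderiv z) p) \<noteq> mult_zero"
  shows "frenet_system J (\<lambda>p. 1 / p) (\<lambda>p. vec_ln (z p)) (\<lambda>p. vec_ln (nat_tangent z p))
    (\<lambda>p. vec_ln (nat_normal z p)) (\<lambda>p. vec_ln (nat_binormal z p))
    (\<lambda>p. ln (nat_curvature z p)) (\<lambda>p. ln (nat_torsion z p))"
proof -
  define T where "T p = vec_ln (mult_vderiv z p)" for p
  define A where "A p = vec_ln (mult_vderiv (mult_vderiv z) p)" for p
  define A' where "A' p = vec_ln (mult_vderiv (mult_vderiv (mult_vderiv z)) p)" for p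
  define N where "N p = (1 / norm (A p)) *\<^sub>R A p" for p
  define B where "B p = cross3 (T p) (N p)" for p
  define K where "K p = norm (A p)" for p
  have curve: "mult_curve J z" and J: "open J" and pos: "\<And>p. p \<in> J \<Longrightarrow> 0 < p"
    using z unfolding naturally_parametrized_def mult_curve_def mult_open_interval_def by auto
  have N_eq: "vec_ln (nat_normal z p) = N p" for p
    by (simp add: nat_normal_def N_def A_def)
  have B_eq: "vec_ln (nat_binormal z p) = B p" for p
    by (simp add: nat_binormal_def nat_tangent_def N_eq B_def T_def)
  have dz: "((\<lambda>p. vec_ln (z p)) has_vector_derivative (1 / p) *\<^sub>R T p) (at p)" if "p \<in> J" for p
    using mult_curve_log_derivative[OF curve that, of 0] by (simp add: T_def)
  have dT: "(T has_vector_derivative (1 / p) *\<^sub>R A p) (at p)" if "p \<in> J" for p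
    using mult_curve_log_derivative[OF curve that, of 1] by (simp add: T_def[abs_def] A_def)
  have dA: "(A has_vector_derivative (1 / p) *\<^sub>R A' p) (at p)" if "p \<in> J" for p
    using mult_curve_log_derivative[OF curve that, of 2]
    by (simp add: A_def[abs_def] A'_def numeral_2_eq_2)
  have TT: "T p \<bullet> T p = 1" if "p \<in> J" for p
    using z that unfolding naturally_parametrized_def mult_norm_def T_def by auto
  have A0: "A p \<noteq> 0" if "p \<in> J" for p
    using nz[OF that] by (auto simp: A_def mult_norm_def)
  then have NN: "N p \<bullet> N p = 1" and AN: "A p = K p *\<^sub>R N p" if "p \<in> J" for p
    using that by (auto simp: N_def K_def dot_square_norm power2_eq_square)
  have TA: "T p \<bullet> A p = 0" if p: "p \<in> J" for p
  proof -
    have "((\<lambda>r. T r \<bullet> T r) has_real_derivative T p \<bullet> (1 / p) *\<^sub>R A p + (1 / p) *\<^sub>R A p \<bullet> T p) (at p)"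
      by (rule has_vector_derivative_inner[OF dT[OF p] dT[OF p]])
    moreover have "((\<lambda>r. T r \<bullet> T r) has_real_derivative 0) (at p)"
      by (rule has_field_derivative_transform_within_open[OF DERIV_const[of 1] J p]) (simp add: TT)
    ultimately have "T p \<bullet> (1 / p) *\<^sub>R A p + (1 / p) *\<^sub>R A p \<bullet> T p = 0"
      using DERIV_unique by blast
    then show ?thesis using pos[OF p] by (simp add: inner_commute)
  qed
  then have TN: "T p \<bullet> N p = 0" if "p \<in> J" for p
    using that by (simp add: N_def)
  note frame = cross3_frame[OF TT NN TN B_def]
  have dN: "(N has_vector_derivative
      (1 / p) *\<^sub>R (ln (nat_torsion z p) *\<^sub>R B p - K p *\<^sub>R T p)) (at p)" if p: "p \<in> J" for p
  proof -
    \<comment> \<open>The third-order derivative \<open>A'\<close> makes \<open>A\<close>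
      differentiable, and the norm is differentiable at the nonzero vector
      \<open>A p\<close>.\<close>
    have "N differentiable (at p)"
      unfolding N_def[abs_def] using dA[OF p] A0[OF p]
      by (intro differentiable_scaleR differentiable_divide differentiable_const
            differentiable_compose[of norm A])
        (auto simp: differentiable_norm_at differentiableI_vector)
    \<comment> \<open>The components of \<open>D\<close> along \<open>N\<close> and \<open>T\<close>
      follow by differentiating the constants N.N = 1 and T.N = 0; the one along \<open>B\<close> is
      the definition of torsion, up to the factor p.\<close>
    then obtain D where D: "(N has_vector_derivative D) (at p)"
      using vector_derivative_works by blast
    have "((\<lambda>r. N r \<bullet> N r) has_real_derivative N p \<bullet> D + D \<bullet> N p) (at p)"
      by (rule has_vector_derivative_inner[OF D D])
    moreover have "((\<lambda>r. N r \<bullet> N r) has_real_derivative 0) (at p)"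
      by (rule has_field_derivative_transform_within_open[OF DERIV_const[of 1] J p]) (simp add: NN)
    ultimately have "N p \<bullet> D + D \<bullet> N p = 0"
      using DERIV_unique by blast
    then have DN: "D \<bullet> N p = 0" by (simp add: inner_commute)
    have "((\<lambda>r. T r \<bullet> N r) has_real_derivative T p \<bullet> D + (1 / p) *\<^sub>R A p \<bullet> N p) (at p)"
      by (rule has_vector_derivative_inner[OF dT[OF p] D])
    moreover have "((\<lambda>r. T r \<bullet> N r) has_real_derivative 0) (at p)"
      by (rule has_field_derivative_transform_within_open[OF DERIV_const[of 0] J p]) (simp add: TN)
    ultimately have "T p \<bullet> D + (1 / p) *\<^sub>R A p \<bullet> N p = 0"
      using DERIV_unique by blast
    then have DT: "D \<bullet> T p = - K p / p"
      using NN[OF p] by (simp add: AN[OF p] inner_commute)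
    have "vec_ln (mult_vderiv (nat_normal z) p) = p *\<^sub>R D"
      by (rule vec_ln_mult_vderiv)
        (use D in \<open>simp only: N_eq\<close>, simp add: nat_normal_def mult_vdivide_def mult_divide_def)
    then have "ln (nat_torsion z p) = p * (D \<bullet> B p)"
      by (simp add: nat_torsion_def mult_inner_def B_eq)
    then have DB: "D \<bullet> B p = ln (nat_torsion z p) / p"
      using pos[OF p] by simp
    have "D = (1 / p) *\<^sub>R (ln (nat_torsion z p) *\<^sub>R B p - K p *\<^sub>R T p)"
      by (subst frame(5)[OF p p p, of D]) (simp add: DN DT DB algebra_simps)
    then show ?thesis using D by simp
  qed
  show ?thesis
    unfolding frenet_system_def N_eq B_eq nat_tangent_def nat_curvature_def ln_mult_norm
      T_def[symmetric] A_def[symmetric] K_def[symmetric]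
    using pos TT NN TN dz dT dN AN by (simp add: B_def)
qed

section \<open>Change of parameter and general regular curves\<close>

lemma frenet_system_compose:
  assumes F: "frenet_system J w X T N B K \<tau>"
    and \<phi>: "\<And>s. s \<in> I \<Longrightarrow> \<phi> s \<in> J \<and> 0 < \<phi>' s \<and> (\<phi> has_real_derivative \<phi>' s) (at s)"
  shows "frenet_system I (\<lambda>s. \<phi>' s * w (\<phi> s)) (X \<circ> \<phi>) (T \<circ> \<phi>) (N \<circ> \<phi>) (B \<circ> \<phi>) (K \<circ> \<phi>) (\<tau> \<circ> \<phi>)"
proof -
  \<comment> \<open>The chain rule only multiplies each derivative by \<open>\<phi>' s\<close>. The
    speed absorbs this factor, so curvature and torsion are merely composed with \<phi>.\<close>
  have chain: "((f \<circ> \<phi>) has_vector_derivative D') (at s)"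
    if "s \<in> I" "(f has_vector_derivative D) (at (\<phi> s))" "D' = \<phi>' s *\<^sub>R D"
    for f :: "real \<Rightarrow> real^3" and D D' s
    using vector_diff_chain_at[of \<phi> "\<phi>' s" s f D] \<phi>[OF that(1)] that(2,3)
    by (simp add: has_real_derivative_iff_has_vector_derivative)
  show ?thesis
    unfolding frenet_system_def
  proof (intro ballI)
    fix s assume s: "s \<in> I"
    note F = F[unfolded frenet_system_def, rule_format, of "\<phi> s"]
    have "((X \<circ> \<phi>) has_vector_derivative (\<phi>' s * w (\<phi> s)) *\<^sub>R (T \<circ> \<phi>) s) (at s)"
      by (rule chain[OF s, of _ "w (\<phi> s) *\<^sub>R T (\<phi> s)"]) (use F \<phi>[OF s] in simp_all)
    moreover have "((T \<circ> \<phi>) has_vector_derivative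
        (\<phi>' s * w (\<phi> s) * (K \<circ> \<phi>) s) *\<^sub>R (N \<circ> \<phi>) s) (at s)"
      by (rule chain[OF s, of _ "(w (\<phi> s) * K (\<phi> s)) *\<^sub>R N (\<phi> s)"])
        (use F \<phi>[OF s] in \<open>simp_all add: mult.assoc\<close>)
    moreover have "((N \<circ> \<phi>) has_vector_derivative (\<phi>' s * w (\<phi> s)) *\<^sub>R
        ((\<tau> \<circ> \<phi>) s *\<^sub>R (B \<circ> \<phi>) s - (K \<circ> \<phi>) s *\<^sub>R (T \<circ> \<phi>) s)) (at s)"
      by (rule chain[OF s, of _ "w (\<phi> s) *\<^sub>R (\<tau> (\<phi> s) *\<^sub>R B (\<phi> s) - K (\<phi> s) *\<^sub>R T (\<phi> s))"])
        (use F \<phi>[OF s] in blast, simp)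
    ultimately show "0 < \<phi>' s * w (\<phi> s) \<and> (T \<circ> \<phi>) s \<bullet> (T \<circ> \<phi>) s = 1 \<and>
        (N \<circ> \<phi>) s \<bullet> (N \<circ> \<phi>) s = 1 \<and> (T \<circ> \<phi>) s \<bullet> (N \<circ> \<phi>) s = 0 \<and>
        (B \<circ> \<phi>) s = cross3 ((T \<circ> \<phi>) s) ((N \<circ> \<phi>) s) \<and>
        ((X \<circ> \<phi>) has_vector_derivative (\<phi>' s * w (\<phi> s)) *\<^sub>R (T \<circ> \<phi>) s) (at s) \<and>
        ((T \<circ> \<phi>) has_vector_derivative
          (\<phi>' s * w (\<phi> s) * (K \<circ> \<phi>) s) *\<^sub>R (N \<circ> \<phi>) s) (at s) \<and>
        ((N \<circ> \<phi>) has_vector_derivative (\<phi>' s * w (\<phi> s)) *\<^sub>R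
          ((\<tau> \<circ> \<phi>) s *\<^sub>R (B \<circ> \<phi>) s - (K \<circ> \<phi>) s *\<^sub>R (T \<circ> \<phi>) s)) (at s)"
      using F \<phi>[OF s] by (intro conjI; (assumption | simp))
  qed
qed

text \<open>\<open>frenet_apparatus\<close> ties its functions to the natural reparametrization on
  \<open>I\<close> only. Since \<open>I\<close> is open, agreement there is enough to transfer
  derivatives.\<close>

lemma frenet_system_cong:
  assumes F: "frenet_system I w X T N B K \<tau>" and I: "open I"
    and eq: "\<And>s. s \<in> I \<Longrightarrow> X s = X' s \<and> T s = T' s \<and> N s = N' s \<and> B s = B' s \<and> K s = K' s \<and> \<tau> s = \<tau>' s"
  shows "frenet_system I w X' T' N' B' K' \<tau>'"
proof -
  have tr: "(f' has_vector_derivative D) (at s)"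
    if "(f has_vector_derivative D) (at s)" "s \<in> I" "\<And>r. r \<in> I \<Longrightarrow> f r = f' r"
    for f f' :: "real \<Rightarrow> real^3" and D s
    using has_vector_derivative_transform_within_open[OF that(1) I that(2,3)] by blast
  show ?thesis
    unfolding frenet_system_def
  proof (intro ballI)
    fix s assume s: "s \<in> I"
    have "(X' has_vector_derivative w s *\<^sub>R T s) (at s)"
      by (rule tr[of X]) (use F s eq in \<open>auto simp: frenet_system_def\<close>)
    moreover have "(T' has_vector_derivative (w s * K s) *\<^sub>R N s) (at s)"
      by (rule tr[of T]) (use F s eq in \<open>auto simp: frenet_system_def\<close>)
    moreover have "(N' has_vector_derivative w s *\<^sub>R (\<tau> s *\<^sub>R B s - K s *\<^sub>R T s)) (at s)"
      by (rule tr[of N]) (use F s eq in \<open>auto simp: frenet_system_def\<close>)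
    ultimately show "0 < w s \<and> T' s \<bullet> T' s = 1 \<and> N' s \<bullet> N' s = 1 \<and> T' s \<bullet> N' s = 0 \<and>
        B' s = cross3 (T' s) (N' s) \<and>
        (X' has_vector_derivative w s *\<^sub>R T' s) (at s) \<and>
        (T' has_vector_derivative (w s * K' s) *\<^sub>R N' s) (at s) \<and>
        (N' has_vector_derivative w s *\<^sub>R (\<tau>' s *\<^sub>R B' s - K' s *\<^sub>R T' s)) (at s)"
      using F s eq[OF s] unfolding frenet_system_def by metis
  qed
qed

lemma frenet_apparatus_frenet_system:
  assumes "frenet_apparatus I x t n b \<kappa> \<tau>"
  obtains w where "frenet_system I w (\<lambda>s. vec_ln (x s)) (\<lambda>s. vec_ln (t s)) (\<lambda>s. vec_ln (n s))
    (\<lambda>s. vec_ln (b s)) (\<lambda>s. ln (\<kappa> s)) (\<lambda>s. ln (\<tau> s))"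
proof -
  obtain J \<phi> z where rep: "natural_reparametrization I x J \<phi> z"
    and eqs: "\<And>s. s \<in> I \<Longrightarrow> mult_norm (mult_vderiv (mult_vderiv z) (\<phi> s)) \<noteq> mult_zero \<and>
        t s = nat_tangent z (\<phi> s) \<and> n s = nat_normal z (\<phi> s) \<and> b s = nat_binormal z (\<phi> s) \<and>
        \<kappa> s = nat_curvature z (\<phi> s) \<and> \<tau> s = nat_torsion z (\<phi> s)"
    and reg: "mult_regular I x"
    using assms unfolding frenet_apparatus_def by blast
  have I: "open I" "I \<subseteq> {0<..}"
    using reg unfolding mult_regular_def mult_curve_def mult_open_interval_def by auto
  have z: "naturally_parametrized J z" and Ck: "mult_Ck_on 3 I \<phi>" and im: "\<phi> ` I = J"
    and \<phi>_incr: "\<And>s. s \<in> I \<Longrightarrow> mult_deriv \<phi> s > mult_zero"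
    and xz: "\<And>s. s \<in> I \<Longrightarrow> x s = z (\<phi> s)"
    using rep unfolding natural_reparametrization_def bij_betw_def by auto
  have \<phi>: "\<phi> s \<in> J \<and> 0 < deriv \<phi> s \<and> (\<phi> has_real_derivative deriv \<phi> s) (at s)" if s: "s \<in> I" for s
  proof (intro conjI)
    show "\<phi> s \<in> J" using im s by blast
    \<comment> \<open>A multiplicative derivative above 1 means that the exponent s \<phi>'/\<phi>
      is positive; as s and \<phi> are positive, so is \<phi>'.\<close>
    have "0 < \<phi> s" and "0 < s" using Ck s I unfolding mult_Ck_on_def by auto
    moreover have "0 < s * deriv \<phi> s / \<phi> s"
      using \<phi>_incr[OF s] by (simp add: mult_deriv_def)
    ultimately show "0 < deriv \<phi> s"
      by (simp add: zero_less_divide_iff zero_less_mult_iff)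
    have "\<forall>j<3. ((mult_deriv ^^ j) \<phi>) differentiable (at s)"
      using Ck s unfolding mult_Ck_on_def by blast
    from this[rule_format, of 0] show "(\<phi> has_real_derivative deriv \<phi> s) (at s)"
      by (simp add: DERIV_deriv_iff_real_differentiable)
  qed
  \<comment> \<open>Surjectivity of \<phi> onto \<open>J\<close> carries the nonvanishing condition
    from the points of \<open>I\<close> to all of \<open>J\<close>.\<close>
  have nz: "mult_norm (mult_vderiv (mult_vderiv z) p) \<noteq> mult_zero" if "p \<in> J" for p
    using eqs im that by blast
  from frenet_system_compose[OF naturally_parametrized_frenet_system[OF z nz] \<phi>]
  have "frenet_system I (\<lambda>s. deriv \<phi> s * (1 / \<phi> s)) (\<lambda>s. vec_ln (x s)) (\<lambda>s. vec_ln (t s))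
      (\<lambda>s. vec_ln (n s)) (\<lambda>s. vec_ln (b s)) (\<lambda>s. ln (\<kappa> s)) (\<lambda>s. ln (\<tau> s))"
    by (rule frenet_system_cong[OF _ I(1)]) (simp_all add: eqs xz)
  then show ?thesis by (rule that)
qed

text \<open>The last two assumptions exclude degenerate pairs. If \<open>y\<close> equals
  \<open>x\<close>, the relation would force constant torsion. For a plane curve and a parallel of
  it, it would force the speed of \<open>y\<close> in logarithmic coordinates to vanish, against
  regularity.\<close>

theorem theorem4p4:
  fixes I :: "real set"
    and x y t n b t' n' b' :: "real \<Rightarrow> real^3"
    and \<kappa> \<tau> \<kappa>' \<tau>' lam :: "real \<Rightarrow> real"
  assumes "frenet_apparatus I x t n b \<kappa> \<tau>"
    and "frenet_apparatus I y t' n' b' \<kappa>' \<tau>'"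
    and "bertrand_partner I x n y n' lam"
    and "\<exists>s\<in>I. lam s \<noteq> mult_zero"
    and "\<exists>s\<in>I. \<tau> s \<noteq> mult_zero"
  shows "\<exists>\<mu>>0. \<forall>s\<in>I. \<kappa> s powr ln (lam s) +\<^sub>* \<tau> s powr ln \<mu> = mult_one"
proof -
  have I: "open I" "connected I" and xpos: "\<And>s i. s \<in> I \<Longrightarrow> 0 < x s $ i"
    using assms(1)
    unfolding frenet_apparatus_def mult_regular_def mult_curve_def mult_open_interval_def mult_Ck_on_def
    by (auto simp: is_interval_connected_1)
  have pos: "0 < \<kappa> s" "0 < \<tau> s" if "s \<in> I" for s
    using assms(1) that
    by (auto simp: frenet_apparatus_def nat_curvature_def nat_torsion_def mult_norm_def mult_inner_def)
  have nn': "\<And>s. s \<in> I \<Longrightarrow> n s = n' s" and lam: "\<And>s. s \<in> I \<Longrightarrow> 0 < lam s"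
    and y: "\<And>s. s \<in> I \<Longrightarrow> y s = x s +\<^sub>v lam s \<cdot>\<^sub>v n s"
    using assms(3) unfolding bertrand_partner_def by auto
  obtain w where F: "frenet_system I w (\<lambda>s. vec_ln (x s)) (\<lambda>s. vec_ln (t s)) (\<lambda>s. vec_ln (n s))
      (\<lambda>s. vec_ln (b s)) (\<lambda>s. ln (\<kappa> s)) (\<lambda>s. ln (\<tau> s))"
    by (rule frenet_apparatus_frenet_system[OF assms(1)])
  obtain w' where F': "frenet_system I w' (\<lambda>s. vec_ln (y s)) (\<lambda>s. vec_ln (t' s))
      (\<lambda>s. vec_ln (n' s)) (\<lambda>s. vec_ln (b' s)) (\<lambda>s. ln (\<kappa>' s)) (\<lambda>s. ln (\<tau>' s))"
    by (rule frenet_apparatus_frenet_system[OF assms(2)])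
  obtain m where m: "\<And>s. s \<in> I \<Longrightarrow> ln (lam s) * ln (\<kappa> s) + m * ln (\<tau> s) = 1"
  proof (rule euclidean_bertrand[OF I F F'])
    show "vec_ln (n' s) = vec_ln (n s)" if "s \<in> I" for s
      using nn'[OF that] by simp
    show "vec_ln (y s) = vec_ln (x s) + ln (lam s) *\<^sub>R vec_ln (n s)" if "s \<in> I" for s
      using y[OF that] xpos[OF that] by (simp add: vec_ln_mult_translate)
    show "\<exists>s\<in>I. ln (lam s) \<noteq> 0"
      using assms(4) lam by (metis ln_eq_zero_iff)
    show "\<exists>s\<in>I. ln (\<tau> s) \<noteq> 0"
      using assms(5) pos(2) by (metis ln_eq_zero_iff)
  qed blast
  \<comment> \<open>Exponentiating the Euclidean relation turns its sum into a product, which is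
    multiplicative addition; hence the witness \<open>exp m\<close> for \<mu>.\<close>
  have "\<kappa> s powr ln (lam s) +\<^sub>* \<tau> s powr ln (exp m) = mult_one" if s: "s \<in> I" for s
    using m[OF s] pos[OF s] by (simp add: powr_def mult_add_def exp_add[symmetric])
  then show ?thesis
    by (intro exI[of _ "exp m"]) simp
qed

end
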